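(* Let $k$ be any positive integer. There is a semi-streaming algorithm which, given any undirected graph $G=(V,E)$ with $n$ vertices and $m$ edges (presented as an edge stream), computes a DFS tree of $G$ in at most $\lceil n/k\rceil$ passes over the stream, using $O(nk)$ space and $O(m\,\alpha(m,n))$ time per pass, where $\alpha(m,n)$ is the inverse Ackermann function.
   Context: Streaming model: the vertex set $V$, $|V|=n$, is known, and the $m$ edges of $E$ are accessible only as a stream. One pass reads all edges of $E$ once, one after another, in an arbitrary order. The algorithm may perform several passes, and between consecutive edges it may do computation using only its local storage. The space bound limits the size of the local storage at all times (measured in words, each able to hold a vertex identifier or an edge in $O(1)$ words). DFS tree: a rooted spanning tree of a connected undirected graph is a DFS tree if and only if every non-tree edge is a back edge, i.e. one of its endpoints is an ancestor of the other in the tree. Convention: $G$ is taken to be connected. A disconnected graph is handled by adding a dummy vertex $r$ adjacent to all vertices and computing a DFS tree rooted at $r$ of the augmented graph (each child subtree of $r$ is then a DFS tree of a connected component of the original graph). *)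

theory Defs
  imports Complex_Main
begin

section \<open>Undirected graphs and DFS trees\<close>

definition ugraph :: "nat set \<Rightarrow> nat set set \<Rightarrow> bool" where
  "ugraph V E \<longleftrightarrow> (\<forall>e\<in>E. \<exists>u\<in>V. \<exists>v\<in>V. u \<noteq> v \<and> e = {u, v})"

definition is_path :: "nat set set \<Rightarrow> nat list \<Rightarrow> nat \<Rightarrow> nat \<Rightarrow> bool" where
  "is_path E p u v \<longleftrightarrow> p \<noteq> [] \<and> hd p = u \<and> last p = v \<and> distinct p \<and>
     successively (\<lambda>x y. {x, y} \<in> E) p"

definition is_cycle :: "nat set set \<Rightarrow> nat list \<Rightarrow> bool" where
  "is_cycle E p \<longleftrightarrow> length p \<ge> 3 \<and> distinct p \<and>
     successively (\<lambda>x y. {x, y} \<in> E) p \<and> {last p, hd p} \<in> E"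

definition connected_graph :: "nat set \<Rightarrow> nat set set \<Rightarrow> bool" where
  "connected_graph V E \<longleftrightarrow> V \<noteq> {} \<and> (\<forall>u\<in>V. \<forall>v\<in>V. \<exists>p. is_path E p u v)"

definition tree :: "nat set \<Rightarrow> nat set set \<Rightarrow> bool" where
  "tree V T \<longleftrightarrow> ugraph V T \<and> connected_graph V T \<and> (\<nexists>p. is_cycle T p)"

definition spanning_tree :: "nat set \<Rightarrow> nat set set \<Rightarrow> nat set set \<Rightarrow> bool" where
  "spanning_tree V E T \<longleftrightarrow> T \<subseteq> E \<and> tree V T"

text \<open>In the tree \<open>T\<close> rooted at \<open>r\<close>, the ancestors of \<open>v\<close> are the vertices on the path
  from \<open>r\<close> to \<open>v\<close>.\<close>

definition ancestor :: "nat set set \<Rightarrow> nat \<Rightarrow> nat \<Rightarrow> nat \<Rightarrow> bool" where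
  "ancestor T r u v \<longleftrightarrow> (\<exists>p. is_path T p r v \<and> u \<in> set p)"

definition dfs_tree :: "nat set \<Rightarrow> nat set set \<Rightarrow> nat \<Rightarrow> nat set set \<Rightarrow> bool" where
  "dfs_tree V E r T \<longleftrightarrow> r \<in> V \<and> spanning_tree V E T \<and>
     (\<forall>u v. {u, v} \<in> E - T \<longrightarrow> ancestor T r u v \<or> ancestor T r v u)"


section \<open>Inverse Ackermann function\<close>

fun ack :: "nat \<Rightarrow> nat \<Rightarrow> nat" where
  "ack 0 j = Suc j"
| "ack (Suc i) 0 = ack i 1"
| "ack (Suc i) (Suc j) = ack i (ack (Suc i) j)"

text \<open>The two-parameter function of Tarjan. Based on the Ackermann-Peter function it is also
  defined for \<open>m < n\<close>, since \<open>ack i 0\<close> is unbounded in \<open>i\<close>.\<close>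

definition inv_ack :: "nat \<Rightarrow> nat \<Rightarrow> nat" where
  "inv_ack m n = (LEAST i. 1 \<le> i \<and> log 2 (real n) \<le> real (ack i (m div n)))"


section \<open>Local computation: a word RAM with bounded storage\<close>

text \<open>The local storage consists of \<open>S\<close> words with addresses \<open>0, \<dots>, S - 1\<close>, each holding a number
  below \<open>S\<close>, so that a word can hold an address. An execution in which an address or an
  (intermediate) value reaches \<open>S\<close> is stuck: the predicates below then have no derivation.
  Time is the number of operations; subtraction is truncated, and a condition holds if its value
  is nonzero.\<close>

type_synonym memory = "nat \<Rightarrow> nat"

datatype expr =
    Const nat
  | Load expr
  | Add expr expr
  | Sub expr expr
  | Mul expr expr

primrec val :: "memory \<Rightarrow> expr \<Rightarrow> nat" where
  "val M (Const c) = c"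
| "val M (Load e) = M (val M e)"
| "val M (Add e f) = val M e + val M f"
| "val M (Sub e f) = val M e - val M f"
| "val M (Mul e f) = val M e * val M f"

primrec fits :: "nat \<Rightarrow> memory \<Rightarrow> expr \<Rightarrow> bool" where
  "fits S M (Const c) \<longleftrightarrow> c < S"
| "fits S M (Load e) \<longleftrightarrow> fits S M e \<and> val M (Load e) < S"
| "fits S M (Add e f) \<longleftrightarrow> fits S M e \<and> fits S M f \<and> val M (Add e f) < S"
| "fits S M (Sub e f) \<longleftrightarrow> fits S M e \<and> fits S M f \<and> val M (Sub e f) < S"
| "fits S M (Mul e f) \<longleftrightarrow> fits S M e \<and> fits S M f \<and> val M (Mul e f) < S"

primrec cost :: "expr \<Rightarrow> nat" where
  "cost (Const c) = 1"
| "cost (Load e) = 1 + cost e"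
| "cost (Add e f) = 1 + cost e + cost f"
| "cost (Sub e f) = 1 + cost e + cost f"
| "cost (Mul e f) = 1 + cost e + cost f"

datatype com =
    Skip
  | Store expr expr
  | Seq com com
  | If expr com com
  | While expr com

text \<open>\<open>exec S c M t M'\<close>: started in \<open>M\<close>, the program \<open>c\<close> terminates in \<open>M'\<close> after time \<open>t\<close>, with
  storage \<open>S\<close> sufficing throughout. \<open>Store a e\<close> writes the value of \<open>e\<close> to address \<open>a\<close>.\<close>

inductive exec :: "nat \<Rightarrow> com \<Rightarrow> memory \<Rightarrow> nat \<Rightarrow> memory \<Rightarrow> bool" for S :: nat where
  Skip: "exec S Skip M 1 M"
| Store: "fits S M a \<Longrightarrow> fits S M e \<Longrightarrow>
    exec S (Store a e) M (1 + cost a + cost e) (M(val M a := val M e))"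
| Seq: "exec S c M t M' \<Longrightarrow> exec S d M' t' M'' \<Longrightarrow> exec S (Seq c d) M (1 + t + t') M''"
| IfTrue: "fits S M b \<Longrightarrow> val M b \<noteq> 0 \<Longrightarrow> exec S c M t M' \<Longrightarrow>
    exec S (If b c d) M (1 + cost b + t) M'"
| IfFalse: "fits S M b \<Longrightarrow> val M b = 0 \<Longrightarrow> exec S d M t M' \<Longrightarrow>
    exec S (If b c d) M (1 + cost b + t) M'"
| WhileFalse: "fits S M b \<Longrightarrow> val M b = 0 \<Longrightarrow> exec S (While b c) M (1 + cost b) M"
| WhileTrue: "fits S M b \<Longrightarrow> val M b \<noteq> 0 \<Longrightarrow> exec S c M t M' \<Longrightarrow>
    exec S (While b c) M' t' M'' \<Longrightarrow> exec S (While b c) M (1 + cost b + t + t') M''"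


section \<open>Multi-pass streaming algorithms\<close>

text \<open>Communication between the environment and the algorithm goes through the first six words:
  the words 0 and 1 initially hold the number \<open>n\<close> of vertices (which are \<open>0, \<dots>, n - 1\<close>) and the
  parameter \<open>k\<close>, all others being 0; each edge read from the stream is placed into the words 2
  and 3; no further pass is made once word 4 is nonzero at the end of a pass; word 5 finally holds
  the address of the output array.\<close>

definition initial_memory :: "nat \<Rightarrow> nat \<Rightarrow> memory" where
  "initial_memory n k = (\<lambda>_. 0)(0 := n, 1 := k)"

text \<open>The edges appear in arbitrary order and orientation.\<close>

type_synonym stream = "(nat \<times> nat) list"

definition edge_stream :: "nat set set \<Rightarrow> stream \<Rightarrow> bool" where
  "edge_stream E es \<longleftrightarrow>
     distinct (map (\<lambda>(u, v). {u, v}) es) \<and> set (map (\<lambda>(u, v). {u, v}) es) = E"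

text \<open>Between two edges an algorithm computes only on its local storage, which persists over all
  passes and is its only state.\<close>

datatype stream_alg = Stream_Alg (at_start: com) (at_edge: com) (at_end: com)

inductive read_edges :: "nat \<Rightarrow> com \<Rightarrow> stream \<Rightarrow> memory \<Rightarrow> nat \<Rightarrow> memory \<Rightarrow> bool"
  for S :: nat and c :: com where
  Nil: "read_edges S c [] M 0 M"
| Cons: "u < S \<Longrightarrow> v < S \<Longrightarrow> exec S c (M(2 := u, 3 := v)) t M' \<Longrightarrow>
    read_edges S c es M' t' M'' \<Longrightarrow> read_edges S c ((u, v) # es) M (1 + t + t') M''"

inductive one_pass :: "nat \<Rightarrow> stream_alg \<Rightarrow> stream \<Rightarrow> memory \<Rightarrow> nat \<Rightarrow> memory \<Rightarrow> bool"
  for S :: nat and A :: stream_alg where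
  "exec S (at_start A) M t M' \<Longrightarrow> read_edges S (at_edge A) es M' t' M'' \<Longrightarrow>
    exec S (at_end A) M'' t'' M''' \<Longrightarrow> one_pass S A es M (t + t' + t'') M'''"

text \<open>\<open>passes S A es M ts M'\<close>: started in \<open>M\<close>, the algorithm halts in \<open>M'\<close> after \<open>length ts\<close> passes;
  the \<open>i\<close>-th pass reads \<open>es i\<close> and takes time \<open>ts ! i\<close>. The order of the edges may thus change from
  pass to pass.\<close>

inductive passes ::
    "nat \<Rightarrow> stream_alg \<Rightarrow> (nat \<Rightarrow> stream) \<Rightarrow> memory \<Rightarrow> nat list \<Rightarrow> memory \<Rightarrow> bool"
  for S :: nat and A :: stream_alg where
  Last: "one_pass S A (es 0) M t M' \<Longrightarrow> M' 4 \<noteq> 0 \<Longrightarrow> passes S A es M [t] M'"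
| More: "one_pass S A (es 0) M t M' \<Longrightarrow> M' 4 = 0 \<Longrightarrow>
    passes S A (\<lambda>i. es (Suc i)) M' ts M'' \<Longrightarrow> passes S A es M (t # ts) M''"

text \<open>The six interface words and the input must fit into the storage.\<close>

definition run :: "nat \<Rightarrow> stream_alg \<Rightarrow> nat \<Rightarrow> nat \<Rightarrow> (nat \<Rightarrow> stream) \<Rightarrow> nat list \<Rightarrow> memory \<Rightarrow> bool"
  where
  "run S A n k es ts M \<longleftrightarrow>
     6 \<le> S \<and> n < S \<and> k < S \<and> passes S A es (initial_memory n k) ts M"

text \<open>The output is the array of parents, in which the root is its own parent.\<close>

definition parent_of :: "memory \<Rightarrow> nat \<Rightarrow> nat" where
  "parent_of M v = M (M 5 + v)"

definition outputs_dfs_tree :: "nat \<Rightarrow> memory \<Rightarrow> nat \<Rightarrow> nat set set \<Rightarrow> bool" where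
  "outputs_dfs_tree S M n E \<longleftrightarrow> M 5 + n \<le> S \<and>
     (\<exists>r<n. parent_of M r = r \<and>
       dfs_tree {..<n} E r {{v, parent_of M v} | v. v < n \<and> v \<noteq> r})"

end

(* In each pass, store for every vertex up to k of its neighbours that were unvisited when the pass
   started, then continue the depth-first search on the stored lists until k more vertices have been
   visited. This is an exact depth-first search of the whole graph: a list with fewer than k entries
   contains all unvisited neighbours, and a list with k entries cannot be exhausted before k vertices
   have been visited in this pass. Each edge and each vertex costs constant time, and n <= m + 1 as
   the graph is connected, so a pass takes time O(m) and no union-find structure is needed. *)

theory Submission
  imports Defs
begin

section \<open>Trees given by a parent function\<close>

text \<open>Correctness rests on one property: a finished vertex has no unvisited neighbour. Hence
  every visited neighbour of a newly visited vertex is still on the stack and becomes its ancestor,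
  so all non-tree edges are back edges. The difficulty in the time bound is that a pass may climb
  past many vertices visited in earlier passes, so its work is not bounded by its own visits. A
  measure adding the list entries, the unvisited vertices and the height of the current vertex falls
  in every step of the search; it is at most linear in the numbers of edges and vertices.\<close>

locale parent_tree =
  fixes V :: "nat set" and p :: "nat \<Rightarrow> nat" and r :: nat
  assumes root_in: "r \<in> V"
    and parent_root: "p r = r"
    and parent_in: "v \<in> V \<Longrightarrow> p v \<in> V"
    and reaches_root: "v \<in> V \<Longrightarrow> \<exists>i. (p ^^ i) v = r"
begin

definition depth :: "nat \<Rightarrow> nat" where
  "depth v = (LEAST i. (p ^^ i) v = r)"

definition tree_edges :: "nat set set" where
  "tree_edges = {{v, p v} | v. v \<in> V \<and> v \<noteq> r}"

lemma depth_parent: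
  assumes "v \<in> V" "v \<noteq> r"
  shows "depth v = Suc (depth (p v))"
proof -
  obtain i where "(p ^^ i) v = r" using reaches_root assms by blast
  moreover have "(p ^^ 0) v \<noteq> r" using assms by simp
  ultimately have "(LEAST i. (p ^^ i) v = r) = Suc (LEAST i. (p ^^ Suc i) v = r)"
    by (rule Least_Suc)
  then show ?thesis by (simp add: depth_def funpow_swap1)
qed

lemma parent_neq: "v \<in> V \<Longrightarrow> v \<noteq> r \<Longrightarrow> p v \<noteq> v"
  using depth_parent by (metis n_not_Suc_n)

lemma depth_root: "depth r = 0"
  by (simp add: depth_def)

lemma parent_edge: "v \<in> V \<Longrightarrow> v \<noteq> r \<Longrightarrow> {v, p v} \<in> tree_edges"
  by (auto simp: tree_edges_def)

lemma tree_edgeD: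
  assumes "{x, y} \<in> tree_edges"
  shows "y = p x \<and> depth x = Suc (depth y) \<or> x = p y \<and> depth y = Suc (depth x)"
  using assms depth_parent by (auto simp: tree_edges_def doubleton_eq_iff)

lemma ugraph_tree_edges: "ugraph V tree_edges"
  unfolding ugraph_def tree_edges_def using parent_in parent_neq by fastforce

text \<open>If two vertices gave the same edge, each would be the parent of the other and hence
  deeper than the other. The count later yields \<open>card V \<le> card E + 1\<close>.\<close>

lemma card_tree_edges:
  shows "card tree_edges = card (V - {r})"
proof -
  have "inj_on (\<lambda>v. {v, p v}) (V - {r})"
  proof (rule inj_onI)
    fix x y assume "x \<in> V - {r}" "y \<in> V - {r}" "{x, p x} = {y, p y}"
    then show "x = y"
      using depth_parent[of x] depth_parent[of y] by (auto simp: doubleton_eq_iff)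
  qed
  moreover have "tree_edges = (\<lambda>v. {v, p v}) ` (V - {r})"
    by (auto simp: tree_edges_def)
  ultimately show ?thesis by (simp add: card_image)
qed

text \<open>The depth bound keeps the path distinct when \<open>v\<close> is appended to the path to
  \<open>p v\<close>; the membership of all iterates turns iterated parents into ancestors.\<close>

lemma root_path:
  assumes "v \<in> V"
  shows "\<exists>q. is_path tree_edges q r v \<and> (\<forall>i. (p ^^ i) v \<in> set q) \<and> (\<forall>x\<in>set q. depth x \<le> depth v)"
  using assms
proof (induction "depth v" arbitrary: v)
  case 0
  then have "v = r" using depth_parent by fastforce
  moreover have "(p ^^ i) r = r" for i by (induction i) (auto simp: parent_root)
  ultimately show ?case by (intro exI[of _ "[r]"]) (auto simp: is_path_def)
next
  case (Suc d)
  then have "v \<noteq> r" using depth_root by auto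
  then have d: "depth v = Suc (depth (p v))" using depth_parent Suc by blast
  then obtain q where q: "is_path tree_edges q r (p v)" "\<forall>i. (p ^^ i) (p v) \<in> set q"
      "\<forall>x\<in>set q. depth x \<le> depth (p v)"
    using Suc parent_in by (metis Suc_inject)
  have "{p v, v} \<in> tree_edges" using parent_edge Suc.prems \<open>v \<noteq> r\<close> by (metis insert_commute)
  then have "is_path tree_edges (q @ [v]) r v"
    using q d by (auto simp: is_path_def successively_append_iff)
  moreover have "(p ^^ i) v \<in> set (q @ [v])" for i
    using q(2) by (cases i) (auto simp: funpow_Suc_right simp del: funpow.simps(2))
  ultimately show ?case using q(3) d by (intro exI[of _ "q @ [v]"]) auto
qed

lemma ancestor_funpow: "v \<in> V \<Longrightarrow> ancestor tree_edges r ((p ^^ i) v) v"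
  unfolding ancestor_def using root_path by blast

text \<open>A deepest vertex of a cycle can only be joined to its parent, so its two neighbours on
  the cycle would coincide, which is impossible for length at least 3.\<close>

lemma acyclic_tree_edges: "\<not> is_cycle tree_edges q"
proof
  assume q: "is_cycle tree_edges q"
  define l where "l = length q"
  have l: "l \<ge> 3" and dist: "distinct q" using q by (auto simp: is_cycle_def l_def)
  have step: "{q ! i, q ! (Suc i mod l)} \<in> tree_edges" if "i < l" for i
  proof (cases "Suc i < l")
    case True
    then show ?thesis using q
      by (auto simp: is_cycle_def l_def successively_conv_nth)
  next
    case False
    then have "Suc i = l" using that by simp
    then show ?thesis using q l
      by (auto simp: is_cycle_def l_def last_conv_nth hd_conv_nth simp flip: \<open>Suc i = l\<close>)
        (metis (no_types, lifting) \<open>Suc i = l\<close> diff_Suc_1 hd_conv_nth l_def last_conv_nth list.size(3) not_less_zero that)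
  qed
  have "depth ` set q \<noteq> {}" using l by (auto simp: l_def)
  then have "Max (depth ` set q) \<in> depth ` set q" by (intro Max_in) auto
  then obtain i where i: "i < l" "Max (depth ` set q) = depth (q ! i)"
    by (auto simp: in_set_conv_nth l_def)
  have max: "depth (q ! j) \<le> depth (q ! i)" if "j < l" for j
    using that by (auto simp flip: i(2) simp: l_def)
  \<comment> \<open>The cyclic predecessor of \<open>i\<close>.\<close>
  define j where "j = (if i = 0 then l - 1 else i - 1)"
  have j: "j < l" "Suc j mod l = i" using l i(1) by (auto simp: j_def)
  have s: "Suc i mod l < l" using l by simp
  have "q ! (Suc i mod l) = p (q ! i)"
    using tree_edgeD[OF step[OF i(1)]] max[OF s] by auto
  moreover have "q ! j = p (q ! i)"
    using tree_edgeD[OF step[OF j(1)]] max[OF j(1)] j(2) by auto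
  ultimately have "Suc i mod l = j"
    using nth_eq_iff_index_eq[OF dist] j(1) s unfolding l_def by metis
  then show False using i(1) l by (auto simp: j_def mod_Suc split: if_splits)
qed

end

section \<open>Composing and reversing paths\<close>

lemma is_path_extend:
  assumes "is_path E q u v" "{v, w} \<in> E"
  shows "\<exists>q'. is_path E q' u w"
proof (cases "w \<in> set q")
  case True
  then obtain xs ys where "q = xs @ w # ys" by (meson split_list)
  then have "is_path E (xs @ [w]) u w"
    using assms(1) by (auto simp: is_path_def successively_append_iff successively_Cons hd_append split: if_splits)
  then show ?thesis by blast
next
  case False
  then have "is_path E (q @ [w]) u w"
    using assms by (auto simp: is_path_def successively_append_iff)
  then show ?thesis by blast
qed

text \<open>The second path is appended edge by edge, and \<open>is_path_extend\<close> cuts the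
  result back whenever a vertex repeats. The inductive claim can therefore speak of arbitrary walks
  from \<open>v\<close>.\<close>

lemma is_path_trans:
  assumes "is_path E q u v" "is_path E q' v w"
  shows "\<exists>q''. is_path E q'' u w"
proof -
  have "\<exists>q''. is_path E q'' u (last xs)"
    if "xs \<noteq> []" "hd xs = v" "successively (\<lambda>x y. {x, y} \<in> E) xs" for xs
    using that
  proof (induction xs rule: rev_induct)
    case (snoc x xs)
    then show ?case
      using assms(1) is_path_extend by (cases "xs = []") (auto simp: successively_append_iff)
  qed simp
  then show ?thesis using assms(2) by (metis is_path_def)
qed

lemma is_path_rev:
  assumes "is_path E q u v" shows "is_path E (rev q) v u"
  using assms by (auto simp: is_path_def hd_rev last_rev insert_commute)

lemma (in parent_tree) tree_tree_edges: "tree V tree_edges"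
proof -
  have "\<exists>q. is_path tree_edges q u v" if "u \<in> V" "v \<in> V" for u v
    using root_path[OF that(1)] root_path[OF that(2)] is_path_trans is_path_rev by metis
  then show ?thesis
    unfolding tree_def connected_graph_def using ugraph_tree_edges acyclic_tree_edges root_in by auto
qed

section \<open>The invariant of depth-first search\<close>

text \<open>The recursion stack is not stored: it consists of the iterated parents of the current vertex
  \<open>c\<close>, and a visited vertex off the stack is finished. The height \<open>h\<close> of \<open>c\<close> pays for the
  steps back to the root in the running time.\<close>

definition dfs_inv ::
    "nat set \<Rightarrow> nat set set \<Rightarrow> nat \<Rightarrow> nat set \<Rightarrow> (nat \<Rightarrow> nat) \<Rightarrow> nat \<Rightarrow> nat \<Rightarrow> bool"
where
  "dfs_inv V E r X p c h \<longleftrightarrow> parent_tree X p r \<and> X \<subseteq> V \<and> c \<in> X \<and> (p ^^ h) c = r \<and> h \<le> card X \<and>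
     (\<forall>v\<in>X. v \<noteq> r \<longrightarrow> {v, p v} \<in> E) \<and>
     (\<forall>x\<in>X. (\<forall>i. (p ^^ i) c \<noteq> x) \<longrightarrow> (\<forall>y. {x, y} \<in> E \<longrightarrow> y \<in> X)) \<and>
     (\<forall>x\<in>X. \<forall>y\<in>X. {x, y} \<in> E \<longrightarrow> (\<exists>i. (p ^^ i) x = y \<or> (p ^^ i) y = x))"

lemma ugraph_edgeD:
  assumes "ugraph V E" "{u, v} \<in> E"
  shows "u \<in> V \<and> v \<in> V \<and> u \<noteq> v"
proof -
  have "\<exists>a\<in>V. \<exists>b\<in>V. a \<noteq> b \<and> {u, v} = {a, b}"
    using assms unfolding ugraph_def by (rule bspec)
  then show ?thesis unfolding doubleton_eq_iff by (elim bexE conjE disjE) simp_all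
qed

text \<open>Meant for setting the parent of a vertex outside \<open>X\<close>: iterates starting in
  \<open>X\<close> stay there and do not see the change.\<close>

lemma funpow_cong_closed:
  assumes "x \<in> X" "\<And>v. v \<in> X \<Longrightarrow> p v \<in> X" "\<And>v. v \<in> X \<Longrightarrow> p' v = p v"
  shows "(p' ^^ i) x = (p ^^ i) x \<and> (p ^^ i) x \<in> X"
  by (induction i) (auto simp: assms)

lemma dfs_inv_visit:
  assumes inv: "dfs_inv V E r X p c h" and w: "w \<in> V" "w \<notin> X" "{c, w} \<in> E"
    and ug: "ugraph V E" and "finite V"
  shows "dfs_inv V E r (insert w X) (p(w := c)) w (Suc h)"
proof -
  let ?p = "p(w := c)"
  interpret parent_tree X p r using inv by (simp add: dfs_inv_def)
  have c: "c \<in> X" using inv by (simp add: dfs_inv_def)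
  have same: "(?p ^^ i) x = (p ^^ i) x" "(p ^^ i) x \<in> X" if "x \<in> X" for x i
    using funpow_cong_closed[of x X p ?p i, OF that parent_in] w(2)
    by (metis fun_upd_other)+
  have Suc_w: "(?p ^^ Suc i) w = (p ^^ i) c" for i
    using same[OF c] by (simp add: funpow_Suc_right del: funpow.simps)
  have tree: "parent_tree (insert w X) ?p r"
  proof
    show "r \<in> insert w X" using root_in by simp
    show "?p r = r" using root_in parent_root w(2) by auto
    show "?p v \<in> insert w X" if "v \<in> insert w X" for v using that c parent_in by auto
    show "\<exists>i. (?p ^^ i) v = r" if "v \<in> insert w X" for v
      using that same reaches_root c Suc_w by (metis insertE)
  qed
  \<comment> \<open>Such a \<open>y\<close> has the unvisited neighbour \<open>w\<close>, so it is
    not finished; hence it is an iterated parent of \<open>c\<close>, and thus of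
    \<open>w\<close>.\<close>
  have anc: "\<exists>i. (?p ^^ i) w = y" if "y \<in> X" "{w, y} \<in> E" for y
  proof -
    have "\<exists>i. (p ^^ i) c = y"
      using inv that w(2) unfolding dfs_inv_def by (metis insert_commute)
    then show ?thesis using Suc_w by metis
  qed
  have noloop: "{w, w} \<notin> E" using ugraph_edgeD[OF ug] by metis
  show ?thesis unfolding dfs_inv_def
  proof (intro conjI ballI allI impI)
    show "parent_tree (insert w X) ?p r" by (rule tree)
    show "insert w X \<subseteq> V" "w \<in> insert w X" using inv w(1) by (auto simp: dfs_inv_def)
    show "(?p ^^ Suc h) w = r" using inv Suc_w by (simp add: dfs_inv_def del: funpow.simps)
    have "finite X" using inv \<open>finite V\<close> finite_subset unfolding dfs_inv_def by metis
    then show "Suc h \<le> card (insert w X)" using inv w(2) by (simp add: dfs_inv_def)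
    show "{v, ?p v} \<in> E" if "v \<in> insert w X" "v \<noteq> r" for v
      using inv that w by (auto simp: dfs_inv_def insert_commute)
    show "y \<in> insert w X" if "x \<in> insert w X" "\<forall>i. (?p ^^ i) w \<noteq> x" "{x, y} \<in> E" for x y
    proof -
      have "x \<noteq> w" using that(2)[rule_format, of 0] by auto
      moreover have "(p ^^ i) c \<noteq> x" for i using that(2) Suc_w by metis
      ultimately show ?thesis using inv that by (auto simp: dfs_inv_def)
    qed
    show "\<exists>i. (?p ^^ i) x = y \<or> (?p ^^ i) y = x"
      if xy: "x \<in> insert w X" "y \<in> insert w X" "{x, y} \<in> E" for x y
    proof -
      consider "x = w" "y \<in> X" | "y = w" "x \<in> X" | "x \<in> X" "y \<in> X"
        using xy noloop by auto
      then show ?thesis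
      proof cases
        case 3
        then show ?thesis using inv xy(3) same unfolding dfs_inv_def by metis
      qed (use anc xy(3) in \<open>metis insert_commute\<close>)+
    qed
  qed
qed

text \<open>Only \<open>c\<close> itself drops off the stack, so \<open>c\<close> is the only vertex
  that newly has to be finished, and this is the assumption on its neighbours.\<close>

lemma dfs_inv_leave:
  assumes inv: "dfs_inv V E r X p c h" and fin: "\<And>y. {c, y} \<in> E \<Longrightarrow> y \<in> X" and "c \<noteq> r"
  shows "\<exists>g. h = Suc g \<and> dfs_inv V E r X p (p c) g"
proof -
  interpret parent_tree X p r using inv by (simp add: dfs_inv_def)
  have "(\<exists>i. (p ^^ i) (p c) = x) \<or> x = c" if "(p ^^ i) c = x" for x i
    using that by (cases i) (auto simp: funpow_swap1 intro: exI[of _ "i - 1"])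
  then have "\<forall>i. (p ^^ i) c \<noteq> x" if "\<forall>i. (p ^^ i) (p c) \<noteq> x" "x \<noteq> c" for x
    using that by blast
  moreover obtain g where "h = Suc g"
    using inv \<open>c \<noteq> r\<close> by (cases h) (auto simp: dfs_inv_def)
  moreover have "(p ^^ g) (p c) = r"
    using inv \<open>h = Suc g\<close> by (simp add: dfs_inv_def funpow_swap1)
  ultimately show ?thesis
    using inv fin parent_in unfolding dfs_inv_def by (metis Suc_leD)
qed

lemma dfs_inv_init: "r \<in> V \<Longrightarrow> dfs_inv V E r {r} (\<lambda>_. r) r 0"
  unfolding dfs_inv_def by (auto intro!: parent_tree.intro intro: exI[of _ 0] elim!: allE[of _ 0])

lemma connected_closed_eq:
  assumes "connected_graph V E" "X \<subseteq> V" "x \<in> X" "\<And>u v. u \<in> X \<Longrightarrow> {u, v} \<in> E \<Longrightarrow> v \<in> X"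
  shows "X = V"
proof -
  have last: "xs \<noteq> [] \<longrightarrow> hd xs \<in> X \<longrightarrow> successively (\<lambda>x y. {x, y} \<in> E) xs \<longrightarrow> last xs \<in> X" for xs
  proof (induction xs)
    case (Cons x xs)
    show ?case
    proof (cases xs)
      case (Cons y ys)
      then show ?thesis using Cons.IH assms(4)[of x y] by simp
    qed simp
  qed simp
  have "V \<subseteq> X"
  proof
    fix v assume "v \<in> V"
    moreover have "x \<in> V" using assms(2,3) by (rule subsetD)
    ultimately obtain q where "is_path E q x v"
      using assms(1) unfolding connected_graph_def by metis
    then show "v \<in> X" using last[of q] assms(3) by (simp add: is_path_def)
  qed
  then show ?thesis using assms(2) by (rule subset_antisym[rotated])
qed

text \<open>With the root current the stack is \<open>r\<close> alone, so every visited vertex is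
  finished and \<open>X\<close> is closed under adjacency. Hence the search cannot run out at the
  root prematurely.\<close>

lemma dfs_inv_root_finished:
  assumes "dfs_inv V E r X p r h" "connected_graph V E" "\<And>y. {r, y} \<in> E \<Longrightarrow> y \<in> X"
  shows "X = V"
proof -
  interpret parent_tree X p r using assms(1) by (simp add: dfs_inv_def)
  have "(p ^^ i) r = r" for i by (induction i) (auto simp: parent_root)
  then have "v \<in> X" if "u \<in> X" "{u, v} \<in> E" for u v
    using assms(1,3) that unfolding dfs_inv_def by (cases "u = r") auto
  moreover have "X \<subseteq> V" using assms(1) by (simp add: dfs_inv_def)
  ultimately show ?thesis using connected_closed_eq[OF assms(2)] root_in by blast
qed

text \<open>Iterated parents are ancestors, which gives the first part. The second counts the edges
  of the computed tree, all of which lie in \<open>E\<close>.\<close>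

lemma dfs_inv_complete:
  assumes inv: "dfs_inv V E r V p c h" and ug: "ugraph V E"
  shows "dfs_tree V E r {{v, p v} | v. v \<in> V \<and> v \<noteq> r}"
    and "finite E \<Longrightarrow> card V \<le> card E + 1"
proof -
  interpret parent_tree V p r using inv by (simp add: dfs_inv_def)
  have sub: "tree_edges \<subseteq> E" using inv by (auto simp: dfs_inv_def tree_edges_def)
  have "ancestor tree_edges r u v \<or> ancestor tree_edges r v u" if "{u, v} \<in> E" for u v
  proof -
    have uv: "u \<in> V" "v \<in> V" using ugraph_edgeD[OF ug that] by simp_all
    then have "\<exists>i. (p ^^ i) u = v \<or> (p ^^ i) v = u"
      using inv that by (simp add: dfs_inv_def)
    then obtain i where "(p ^^ i) u = v \<or> (p ^^ i) v = u" ..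
    then show ?thesis using ancestor_funpow[OF uv(1), of i] ancestor_funpow[OF uv(2), of i] by auto
  qed
  then show "dfs_tree V E r {{v, p v} | v. v \<in> V \<and> v \<noteq> r}"
    unfolding dfs_tree_def spanning_tree_def tree_edges_def[symmetric]
    using root_in sub tree_tree_edges by simp
  show "card V \<le> card E + 1" if "finite E"
    using card_mono[OF that sub] card_Diff_singleton[OF root_in]
    unfolding card_tree_edges by linarith
qed

section \<open>Bounded execution\<close>

text \<open>Only loop-free programs get a weakest precondition; loops are treated by \<open>runs_While\<close>, whose
  variant is a ghost parameter of the invariant rather than a function of the memory.\<close>

primrec wp :: "nat \<Rightarrow> com \<Rightarrow> memory \<Rightarrow> (memory \<Rightarrow> bool) \<Rightarrow> bool" where
  "wp S Skip M Q \<longleftrightarrow> Q M"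
| "wp S (Store a e) M Q \<longleftrightarrow> fits S M a \<and> fits S M e \<and> Q (M(val M a := val M e))"
| "wp S (Seq c d) M Q \<longleftrightarrow> wp S c M (\<lambda>M'. wp S d M' Q)"
| "wp S (If b c d) M Q \<longleftrightarrow> fits S M b \<and> (if val M b \<noteq> 0 then wp S c M Q else wp S d M Q)"
| "wp S (While b c) M Q \<longleftrightarrow> False"

text \<open>The 0 at a loop is a default value: \<open>wp\<close> is false there, so
  \<open>wp_runs\<close> holds vacuously.\<close>

primrec wcost :: "com \<Rightarrow> nat" where
  "wcost Skip = 1"
| "wcost (Store a e) = 1 + cost a + cost e"
| "wcost (Seq c d) = 1 + wcost c + wcost d"
| "wcost (If b c d) = 1 + cost b + max (wcost c) (wcost d)"
| "wcost (While b c) = 0"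

text \<open>Total correctness with a time bound; the existence of a derivation also says that the
  storage suffices.\<close>

definition runs :: "nat \<Rightarrow> com \<Rightarrow> memory \<Rightarrow> nat \<Rightarrow> (memory \<Rightarrow> bool) \<Rightarrow> bool" where
  "runs S c M b Q \<longleftrightarrow> (\<exists>t M'. exec S c M t M' \<and> t \<le> b \<and> Q M')"

lemma wp_runs: "wp S c M Q \<Longrightarrow> runs S c M (wcost c) Q"
proof (induction c arbitrary: M Q)
  case Skip
  then show ?case unfolding runs_def by (intro exI conjI) (rule exec.Skip, auto)
next
  case (Store a e)
  then show ?case unfolding runs_def
    by (intro exI conjI) (rule exec.Store, auto)
next
  case (Seq c d)
  then obtain t M' where 1: "exec S c M t M'" "t \<le> wcost c" "wp S d M' Q"
    unfolding runs_def wp.simps by blast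
  then obtain t' M'' where "exec S d M' t' M''" "t' \<le> wcost d" "Q M''"
    using Seq.IH(2) unfolding runs_def by blast
  with 1 show ?case unfolding runs_def
    by (intro exI conjI) (rule exec.Seq, auto)
next
  case (If b c d)
  show ?case
  proof (cases "val M b = 0")
    case True
    then obtain t M' where "exec S d M t M'" "t \<le> wcost d" "Q M'"
      using If.IH(2)[of M Q] If.prems unfolding runs_def by auto
    with True If.prems show ?thesis unfolding runs_def
      by (intro exI conjI) (rule exec.IfFalse, auto)
  next
    case False
    then obtain t M' where "exec S c M t M'" "t \<le> wcost c" "Q M'"
      using If.IH(1)[of M Q] If.prems unfolding runs_def by auto
    with False If.prems show ?thesis unfolding runs_def
      by (intro exI conjI) (rule exec.IfTrue, auto)
  qed
qed simp

lemma runs_Seq: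
  assumes "runs S c M b (\<lambda>M'. runs S d M' b' Q)"
  shows "runs S (Seq c d) M (1 + b + b') Q"
proof -
  obtain t M' where 1: "exec S c M t M'" "t \<le> b" "runs S d M' b' Q"
    using assms unfolding runs_def by blast
  then obtain t' M'' where "exec S d M' t' M''" "t' \<le> b'" "Q M''"
    unfolding runs_def by blast
  with 1 show ?thesis unfolding runs_def
    by (intro exI conjI) (rule exec.Seq, auto)
qed

lemma runs_mono:
  "runs S c M b Q \<Longrightarrow> b \<le> b' \<Longrightarrow> (\<And>M'. Q M' \<Longrightarrow> Q' M') \<Longrightarrow> runs S c M b' Q'"
  unfolding runs_def by (meson order_trans)

lemma runs_While:
  assumes "I m M"
    and "\<And>m M. I m M \<Longrightarrow> fits S M e"
    and "\<And>m M. I m M \<Longrightarrow> val M e \<noteq> 0 \<Longrightarrow> runs S c M b (\<lambda>M'. \<exists>m'<m. I m' M')"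
    and "m \<le> h"
  shows "runs S (While e c) M (1 + cost e + h * (1 + cost e + b)) (\<lambda>M'. (\<exists>m'. I m' M') \<and> val M' e = 0)"
  using assms(1,4)
proof (induction m arbitrary: M h rule: less_induct)
  case (less m)
  show ?case
  proof (cases "val M e = 0")
    case True
    then show ?thesis unfolding runs_def using less.prems assms(2)
      by (intro exI conjI) (rule exec.WhileFalse, auto)
  next
    case False
    then obtain t M' m' where 1: "exec S c M t M'" "t \<le> b" "I m' M'" "m' < m"
      using assms(3) less.prems unfolding runs_def by blast
    then obtain g where g: "h = Suc g" "m' \<le> g"
      using less.prems by (cases h) auto
    obtain t' M'' where 2: "exec S (While e c) M' t' M''"
      "t' \<le> 1 + cost e + g * (1 + cost e + b)" "\<exists>m'. I m' M''" "val M'' e = 0"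
      using less.IH[OF 1(4,3) g(2)] unfolding runs_def by blast
    have "exec S (While e c) M (1 + cost e + t + t') M''"
      using exec.WhileTrue[OF assms(2)[OF less.prems(1)] False 1(1) 2(1)] .
    moreover have "1 + cost e + t + t' \<le> 1 + cost e + h * (1 + cost e + b)"
      using 1(2) 2(2) g(1) by (simp add: algebra_simps)
    ultimately show ?thesis unfolding runs_def using 2 by blast
  qed
qed

lemma wp_mono: "wp S c M Q \<Longrightarrow> (\<And>M'. Q M' \<Longrightarrow> Q' M') \<Longrightarrow> wp S c M Q'"
proof (induction c arbitrary: M Q Q')
  case (Seq c d)
  from Seq.prems(1) show ?case unfolding wp.simps
    by (rule Seq.IH(1)) (rule Seq.IH(2)[OF _ Seq.prems(2)])
next
  case (If b c d)
  show ?case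
    using If.prems(1) If.IH(1)[of M Q Q', OF _ If.prems(2)] If.IH(2)[of M Q Q', OF _ If.prems(2)] by simp
qed auto

section \<open>The algorithm\<close>

abbreviation W :: "nat \<Rightarrow> expr" where
  "W i \<equiv> Load (Const i)"

text \<open>Word 6 holds the number of visited vertices, word 7 the current vertex, word 8 the number of
  visited vertices at which the pass stops; word 9 is scratch. The arrays from address 10 on are:
  parents, list lengths, visited flags, and for each vertex a list with room for \<open>k\<close> neighbours.
  An unvisited root (word 6 is 0) identifies the first pass.\<close>

definition parent_addr :: "expr \<Rightarrow> expr" where
  "parent_addr v = Add (Const 10) v"

definition count_addr :: "expr \<Rightarrow> expr" where
  "count_addr v = Add (Add (Const 10) (W 0)) v"

definition visited_addr :: "expr \<Rightarrow> expr" where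
  "visited_addr v = Add (Add (Const 10) (Mul (Const 2) (W 0))) v"

definition list_addr :: "expr \<Rightarrow> expr \<Rightarrow> expr" where
  "list_addr v j = Add (Add (Add (Const 10) (Mul (Const 3) (W 0))) (Mul v (W 1))) j"

definition init_code :: com where
  "init_code = If (W 6) Skip
     (Seq (Store (visited_addr (Const 0)) (Const 1))
       (Seq (Store (Const 6) (Const 1)) (Store (Const 5) (Const 10))))"

text \<open>With truncated subtraction, \<open>n - (n - (s + k))\<close> is
  \<open>min n (s + k)\<close>. Word 9 becomes the counter of the clearing loop.\<close>

definition limit_code :: com where
  "limit_code =
     Seq (Store (Const 8) (Sub (W 0) (Sub (W 0) (Add (W 6) (W 1))))) (Store (Const 9) (W 0))"

definition clear_code :: com where
  "clear_code =
     Seq (Store (Const 9) (Sub (W 9) (Const 1))) (Store (count_addr (W 9)) (Const 0))"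

text \<open>The product encodes a conjunction: it is nonzero iff the vertex in word \<open>b\<close>
  is unvisited and the list of the vertex in word \<open>a\<close> has room.\<close>

definition push_code :: "nat \<Rightarrow> nat \<Rightarrow> com" where
  "push_code a b =
     If (Mul (Sub (Const 1) (Load (visited_addr (W b)))) (Sub (W 1) (Load (count_addr (W a)))))
       (Seq (Store (list_addr (W a) (Load (count_addr (W a)))) (W b))
         (Store (count_addr (W a)) (Add (Load (count_addr (W a))) (Const 1))))
       Skip"

definition visit_code :: com where
  "visit_code =
     Seq (Store (visited_addr (W 9)) (Const 1))
       (Seq (Store (parent_addr (W 9)) (W 7))
         (Seq (Store (Const 7) (W 9)) (Store (Const 6) (Add (W 6) (Const 1)))))"

text \<open>Once lowered, the count is the index of the removed entry, which is still in
  memory.\<close>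

definition pop_code :: com where
  "pop_code =
     Seq (Store (count_addr (W 7)) (Sub (Load (count_addr (W 7))) (Const 1)))
       (Store (Const 9) (Load (list_addr (W 7) (Load (count_addr (W 7))))))"

definition search_code :: com where
  "search_code = If (Load (count_addr (W 7)))
     (Seq pop_code (If (Load (visited_addr (W 9))) Skip visit_code))
     (Store (Const 7) (Load (parent_addr (W 7))))"

text \<open>Each edge is offered to the lists of both endpoints. By truncation, the value finally
  stored in word 4 is nonzero iff word 6 has reached \<open>n\<close>.\<close>

definition dfs_alg :: stream_alg where
  "dfs_alg = Stream_Alg
     (Seq init_code (Seq limit_code (While (W 9) clear_code)))
     (Seq (push_code 2 3) (push_code 3 2))
     (Seq (While (Sub (W 8) (W 6)) search_code)
       (Store (Const 4) (Sub (Const 1) (Sub (W 0) (W 6)))))"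

section \<open>Representation of the search state in memory\<close>

definition repr ::
    "nat \<Rightarrow> nat \<Rightarrow> memory \<Rightarrow> nat set \<Rightarrow> (nat \<Rightarrow> nat) \<Rightarrow> nat \<Rightarrow> (nat \<Rightarrow> nat list) \<Rightarrow> bool"
where
  "repr n k M X p c L \<longleftrightarrow>
     M 0 = n \<and> M 1 = k \<and> M 5 = 10 \<and> M 6 = card X \<and> M 7 = c \<and>
     (\<forall>v<n. M (10 + v) = p v \<and> M (10 + n + v) = length (L v) \<and>
       M (10 + 2 * n + v) = of_bool (v \<in> X) \<and> length (L v) \<le> k \<and>
       (\<forall>j<length (L v). M (10 + 3 * n + v * k + j) = L v ! j))"

lemma repr_scratch:
  "repr n k M X p c L \<Longrightarrow> a \<in> {2, 3, 4, 8, 9} \<Longrightarrow> repr n k (M(a := x)) X p c L"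
  by (elim insertE emptyE) (simp_all add: repr_def)

text \<open>Division by \<open>k\<close> recovers the vertex, so the blocks of different vertices
  are disjoint.\<close>

lemma list_slot_eq:
  fixes u v i j k :: nat
  assumes "u * k + i = v * k + j" "i < k" "j < k"
  shows "u = v \<and> i = j"
proof -
  have "(u * k + i) div k = u" "(v * k + j) div k = v" using assms(2,3) by simp_all
  then have "u = v" using assms(1) by simp
  then show ?thesis using assms(1) by simp
qed

lemma repr_push:
  assumes "repr n k M X p c L" "u < n" "length (L u) < k"
  shows "repr n k (M(10 + 3 * n + u * k + length (L u) := w, 10 + n + u := Suc (length (L u))))
    X p c (L(u := L u @ [w]))"
proof -
  have slot: "v * k + j \<noteq> u * k + length (L u)" if "v < n" "j < length (L v)" for v j
  proof
    assume eq: "v * k + j = u * k + length (L u)"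
    have "length (L v) \<le> k" using assms(1) that(1) by (simp add: repr_def)
    then have "v = u \<and> j = length (L u)" using list_slot_eq[OF eq] assms(3) that(2) by simp
    then show False using that(2) by simp
  qed
  show ?thesis
    using assms slot unfolding repr_def by (auto simp: nth_append less_Suc_eq)
qed

text \<open>Changing the count is enough, since \<open>repr\<close> leaves the slots beyond the
  length of a list unconstrained.\<close>

lemma repr_pop:
  assumes "repr n k M X p c L" "u < n"
  shows "repr n k (M(10 + n + u := length (L u) - 1)) X p c (L(u := butlast (L u)))"
  using assms unfolding repr_def by (auto simp: nth_butlast)

lemma repr_visit:
  assumes "repr n k M X p c L" "w < n" "w \<notin> X" "finite X"
  shows "repr n k (M(10 + 2 * n + w := 1, 10 + w := c, 7 := w, 6 := Suc (card X)))
    (insert w X) (p(w := c)) w L"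
  using assms unfolding repr_def by auto

lemma repr_move: "repr n k M X p c L \<Longrightarrow> repr n k (M(7 := c')) X p c' L"
  unfolding repr_def by auto

lemma reprD:
  assumes "repr n k M X p c L"
  shows "M 0 = n" "M (Suc 0) = k" "M 5 = 10" "M 6 = card X" "M 7 = c"
    and "v < n \<Longrightarrow> M (10 + v) = p v"
    and "v < n \<Longrightarrow> M (10 + n + v) = length (L v)"
    and "v < n \<Longrightarrow> M (10 + 2 * n + v) = of_bool (v \<in> X)"
    and "v < n \<Longrightarrow> length (L v) \<le> k"
    and "v < n \<Longrightarrow> j < length (L v) \<Longrightarrow> M (10 + 3 * n + v * k + j) = L v ! j"
  using assms by (auto simp: repr_def)

definition push_list ::
    "nat set \<Rightarrow> nat \<Rightarrow> nat \<Rightarrow> nat \<Rightarrow> (nat \<Rightarrow> nat list) \<Rightarrow> nat \<Rightarrow> nat list"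
where
  "push_list X k u v L = (if v \<notin> X \<and> length (L u) < k then L(u := L u @ [v]) else L)"

section \<open>Word sizes and the loop-free programs\<close>

locale storage =
  fixes S n k :: nat
  assumes n: "1 \<le> n" and k: "1 \<le> k" and S: "100 * (n * k) \<le> S"
begin

lemma storage_bounds: "n \<le> n * k" "k \<le> n * k" "1 \<le> n * k"
  using n k by simp_all

lemma slot_bound:
  assumes "v < n" shows "v * k + k \<le> n * k"
proof -
  have "Suc v * k \<le> n * k" using assms by (intro mult_le_mono1) simp
  then show ?thesis by simp
qed

text \<open>Since \<open>n\<close>, \<open>k\<close> and 1 are all at most \<open>n * k\<close>,
  each of these values is at most a small multiple of \<open>n * k\<close>; the factor 100 leaves
  ample slack.\<close>

lemma constant_bounds:
  "0 < S" "Suc 0 < S" "2 < S" "3 < S" "4 < S" "5 < S" "6 < S" "7 < S" "8 < S" "9 < S" "10 < S"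
  "n < S" "2 * n < S" "3 * n < S" "10 + n < S" "10 + 2 * n < S" "10 + 3 * n < S"
  "k < S" "n + k < S"
  using storage_bounds S by linarith+

lemma vertex_bounds:
  assumes "v < n"
  shows "v < S" "Suc v < S" "10 + v < S" "10 + n + v < S" "10 + 2 * n + v < S"
    "v * k < S" "10 + 3 * n + v * k < S"
  using storage_bounds S slot_bound[OF assms] assms by linarith+

lemma slot_bounds:
  assumes "v < n" "j \<le> k"
  shows "10 + 3 * n + v * k + j < S" "j < S" "Suc j < S" "k - j < S"
  using storage_bounds S slot_bound[OF assms(1)] assms by linarith+

lemmas bounds = constant_bounds vertex_bounds slot_bounds

lemma wp_push:
  assumes rep: "repr n k M X p c L" and uv: "M a = u" "M b = v" "u < n" "v < n"
    and ab: "a \<in> {2, 3}" "b \<in> {2, 3}"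
  shows "wp S (push_code a b) M
    (\<lambda>M'. repr n k M' X p c (push_list X k u v L) \<and> M' 2 = M 2 \<and> M' 3 = M 3 \<and> M' 8 = M 8)"
proof -
  note facts = reprD(1,2)[OF rep] reprD(7,9)[OF rep uv(3)] reprD(8)[OF rep uv(4)]
  have ab_less: "a < S" "b < S" using ab bounds by auto
  \<comment> \<open>The new slot lies beyond the count of \<open>u\<close> (compared after
    cancelling \<open>10 + n\<close>) and beyond words 2 and 3, so writing it does not disturb later
    reads.\<close>
  have neq: "u \<noteq> 2 * n + (u * k + length (L u))" "a \<noteq> 10 + 3 * n + u * k + length (L u)"
    "b \<noteq> 10 + 3 * n + u * k + length (L u)"
    using uv(3) ab by auto
  show ?thesis
    unfolding push_code_def visited_addr_def count_addr_def list_addr_def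
    using repr_push[OF rep uv(3), of v] rep
    by (simp add: facts uv ab_less neq bounds slot_bounds[OF uv(3) facts(4)] push_list_def)
qed

lemma wp_pop:
  assumes rep: "repr n k M X p c L" and c: "c < n" and L: "L c \<noteq> []" and last: "last (L c) < n"
  shows "wp S pop_code M
    (\<lambda>M'. repr n k M' X p c (L(c := butlast (L c))) \<and> M' 9 = last (L c) \<and> M' 8 = M 8)"
proof -
  note facts = reprD(1,2,5)[OF rep] reprD(7,9)[OF rep c]
  obtain j where j: "length (L c) = Suc j" using L by (cases "L c") auto
  have Suc_j: "Suc j \<le> k" "j \<le> k" "j < S" "Suc j < S" using facts(5) j slot_bounds[OF c, of "Suc j"] by auto
  have slot: "M (10 + 3 * n + c * k + j) = last (L c)"
    using reprD(10)[OF rep c, of j] L j by (simp add: last_conv_nth)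
  have neq: "2 * n + (c * k + j) \<noteq> c" using c by simp
  show ?thesis
    unfolding pop_code_def count_addr_def list_addr_def
    using repr_scratch[OF repr_pop[OF rep c], of 9 "last (L c)"]
    by (simp add: facts j Suc_j slot neq c last bounds)
qed

lemma wp_visit:
  assumes rep: "repr n k M X p c L" and w: "M 9 = w" "w < n" "w \<notin> X" and c: "c < n"
    and X: "X \<subseteq> {..<n}"
  shows "wp S visit_code M (\<lambda>M'. repr n k M' (insert w X) (p(w := c)) w L \<and> M' 8 = M 8)"
proof -
  have fin: "finite X" using X finite_subset by blast
  have "card (insert w X) \<le> n" using card_mono[of "{..<n}" "insert w X"] X w(2) by simp
  then have "card X < n" using fin w(3) by simp
  then show ?thesis
    unfolding visit_code_def visited_addr_def parent_addr_def
    using repr_visit[OF rep w(2,3) fin]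
    by (simp add: reprD(1,2,4,5)[OF rep] w c bounds)
qed

lemma repr_clear:
  "repr n k M X p c L \<Longrightarrow> u < n \<Longrightarrow> repr n k (M(10 + n + u := 0)) X p c (L(u := []))"
  unfolding repr_def by auto

text \<open>Zeroed memory already makes 0 the current vertex and its own parent and all lists empty;
  this is why vertex 0 is the root.\<close>

lemma repr_init:
  "repr n k ((initial_memory n k)(10 + 2 * n := Suc 0, 6 := Suc 0, 5 := 10)) {0} (\<lambda>_. 0) 0 (\<lambda>_. [])"
  unfolding repr_def initial_memory_def by auto

lemma wp_init:
  assumes "M = initial_memory n k \<and> Q (M(10 + 2 * n := Suc 0, 6 := Suc 0, 5 := 10)) \<or> 0 < M 6 \<and> M 6 < S \<and> Q M"
  shows "wp S init_code M Q"
  using assms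
proof
  assume "M = initial_memory n k \<and> Q (M(10 + 2 * n := Suc 0, 6 := Suc 0, 5 := 10))"
  then show ?thesis unfolding init_code_def visited_addr_def
    by (auto simp: bounds initial_memory_def)
qed (simp add: init_code_def bounds)

lemma wp_limit:
  assumes "repr n k M X p c L" "card X \<le> n"
  shows "wp S limit_code M (\<lambda>M'. repr n k M' X p c L \<and> M' 8 = min n (card X + k) \<and> M' 9 = n)"
proof -
  have "card X + k < S" "card X < S" "n - (n - (card X + k)) = min n (card X + k)"
    "n - (card X + k) < S" "min n (card X + k) < S"
    using assms(2) bounds by auto
  then show ?thesis
    unfolding limit_code_def
    by (simp add: reprD[OF assms(1)] bounds repr_scratch assms(1))
qed

lemma runs_clear:
  assumes "repr n k M X p c L" "M 9 = n"
  shows "runs S (While (W 9) clear_code) M (1 + cost (W 9) + n * (1 + cost (W 9) + wcost clear_code))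
    (\<lambda>M'. \<exists>L. repr n k M' X p c L \<and> (\<forall>v<n. L v = []) \<and> M' 8 = M 8)"
proof -
  \<comment> \<open>Word 9 counts down, so the lists from index \<open>m\<close> on are already
    cleared, and \<open>m\<close> itself is the variant.\<close>
  define I where "I = (\<lambda>m M'. M' 9 = m \<and> m \<le> n \<and> M' 8 = M 8 \<and>
    (\<exists>L. repr n k M' X p c L \<and> (\<forall>v<n. m \<le> v \<longrightarrow> L v = [])))"
  have "runs S clear_code M' (wcost clear_code) (\<lambda>M''. \<exists>m'<m. I m' M'')"
    if I: "I m M'" and nz: "val M' (W 9) \<noteq> 0" for m M'
  proof (rule wp_runs)
    obtain j where j: "m = Suc j" using I nz by (cases m) (auto simp: I_def)
    obtain L where L: "repr n k M' X p c L" "\<forall>v<n. m \<le> v \<longrightarrow> L v = []"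
      using I by (auto simp: I_def)
    have "j < n" using I j by (simp add: I_def)
    have "I j (M'(9 := j, 10 + n + j := 0))"
      using I L(2) j \<open>j < n\<close> repr_clear[OF repr_scratch[OF L(1), of 9 j], of j] unfolding I_def
      by (auto intro!: exI[of _ "L(j := [])"])
    then show "wp S clear_code M' (\<lambda>M''. \<exists>m'<m. I m' M'')"
      unfolding clear_code_def count_addr_def
      using I j by (auto simp: I_def bounds \<open>j < n\<close> reprD[OF L(1)])
  qed
  moreover have "fits S M' (W 9)" if "I m M'" for m M'
    using that bounds by (auto simp: I_def)
  moreover have "I n M" using assms by (auto simp: I_def)
  ultimately have "runs S (While (W 9) clear_code) M
      (1 + cost (W 9) + n * (1 + cost (W 9) + wcost clear_code))
      (\<lambda>M'. (\<exists>m'. I m' M') \<and> val M' (W 9) = 0)"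
    using runs_While[of I n M S "W 9" clear_code "wcost clear_code" n] by blast
  then show ?thesis by (rule runs_mono) (auto simp: I_def)
qed

end

section \<open>Contents of the neighbour lists\<close>

lemma sum_length_update:
  fixes L :: "nat \<Rightarrow> 'a list"
  assumes "u < n"
  shows "(\<Sum>v<n. length ((L(u := xs)) v)) + length (L u) = (\<Sum>v<n. length (L v)) + length xs"
  using assms by (simp add: sum.remove[of "{..<n}" u])

text \<open>\<open>P\<close> stands for the edges read so far in the pass and \<open>d\<close> for
  their number; each of them contributes at most two entries.\<close>

definition lists_inv ::
    "nat \<Rightarrow> nat \<Rightarrow> nat set \<Rightarrow> nat set set \<Rightarrow> nat \<Rightarrow> (nat \<Rightarrow> nat list) \<Rightarrow> bool"
where
  "lists_inv n k X P d L \<longleftrightarrow> (\<Sum>u<n. length (L u)) \<le> 2 * d \<and>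
     (\<forall>u<n. distinct (L u) \<and> (\<forall>v\<in>set (L u). v \<notin> X \<and> {u, v} \<in> P) \<and>
       (length (L u) < k \<longrightarrow> (\<forall>v. {u, v} \<in> P \<longrightarrow> v \<notin> X \<longrightarrow> v \<in> set (L u))))"

text \<open>Distinctness survives because all stored entries come from edges in \<open>P\<close>, to
  which the new edge does not belong. It is what makes a full list count as \<open>k\<close>
  different vertices.\<close>

lemma lists_inv_push:
  assumes inv: "lists_inv n k X P d L" and uv: "u < n" "v < n" "u \<noteq> v" "{u, v} \<notin> P"
  shows "lists_inv n k X (insert {u, v} P) (Suc d) (push_list X k v u (push_list X k u v L))"
proof -
  let ?L = "push_list X k v u (push_list X k u v L)"
  have sum: "(\<Sum>w<n. length (push_list X k x y L w)) \<le> Suc (\<Sum>w<n. length (L w))" if "x < n" for x y L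
    using sum_length_update[OF that, of L "L x @ [y]"] by (simp add: push_list_def)
  have "(\<Sum>w<n. length (?L w)) \<le> 2 * Suc d"
    using sum[OF uv(1), of v L] sum[OF uv(2), of u "push_list X k u v L"] inv
    by (simp add: lists_inv_def)
  moreover have "distinct (?L x) \<and> (\<forall>y\<in>set (?L x). y \<notin> X \<and> {x, y} \<in> insert {u, v} P) \<and>
      (length (?L x) < k \<longrightarrow> (\<forall>y. {x, y} \<in> insert {u, v} P \<longrightarrow> y \<notin> X \<longrightarrow> y \<in> set (?L x)))"
    if "x < n" for x
  proof -
    have x: "distinct (L x)" "\<forall>y\<in>set (L x). y \<notin> X \<and> {x, y} \<in> P"
      "length (L x) < k \<Longrightarrow> \<forall>y. {x, y} \<in> P \<longrightarrow> y \<notin> X \<longrightarrow> y \<in> set (L x)"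
      using inv that by (simp_all add: lists_inv_def)
    consider (u) "x = u" | (v) "x = v" | (other) "x \<noteq> u" "x \<noteq> v" by blast
    then show ?thesis
    proof cases
      case u
      then have "?L x = (if v \<notin> X \<and> length (L u) < k then L u @ [v] else L u)"
        using uv by (simp add: push_list_def)
      moreover have "v \<notin> set (L u)" using x(2) u uv(4) by auto
      ultimately show ?thesis using x u by (auto simp: doubleton_eq_iff)
    next
      case v
      then have "?L x = (if u \<notin> X \<and> length (L v) < k then L v @ [u] else L v)"
        using uv by (simp add: push_list_def)
      moreover have "u \<notin> set (L v)" using x(2) v uv(4) by (auto simp: insert_commute)
      ultimately show ?thesis using x v by (auto simp: doubleton_eq_iff insert_commute)
    next
      case other
      then have "?L x = L x" by (simp add: push_list_def)
      then show ?thesis using x other by (auto simp: doubleton_eq_iff)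
    qed
  qed
  ultimately show ?thesis by (simp add: lists_inv_def)
qed

lemma (in storage) read_edges_push:
  assumes "ugraph {..<n} E" "repr n k M X p c L" "lists_inv n k X P d L"
    and "distinct (map (\<lambda>(u, v). {u, v}) es)" "set (map (\<lambda>(u, v). {u, v}) es) \<subseteq> E - P"
  shows "\<exists>t M' L'. read_edges S (at_edge dfs_alg) es M t M' \<and>
    t \<le> length es * (1 + wcost (at_edge dfs_alg)) \<and> M' 8 = M 8 \<and> repr n k M' X p c L' \<and>
    lists_inv n k X (P \<union> set (map (\<lambda>(u, v). {u, v}) es)) (d + length es) L'"
  using assms(2-)
proof (induction es arbitrary: M L P d)
  case Nil
  then show ?case by (intro exI conjI) (rule read_edges.Nil, simp_all)
next
  case (Cons e es)
  obtain u v where e: "e = (u, v)" by (cases e)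
  then have uv: "u < n" "v < n" "u \<noteq> v" "{u, v} \<notin> P"
    using ugraph_edgeD[OF assms(1), of u v] Cons.prems(4) by auto
  let ?M = "M(2 := u, 3 := v)" and ?L = "push_list X k v u (push_list X k u v L)"
  have rep: "repr n k ?M X p c L" using Cons.prems(1) by (intro repr_scratch) auto
  have "wp S (at_edge dfs_alg) ?M (\<lambda>M'. repr n k M' X p c ?L \<and> M' 8 = M 8)"
    unfolding dfs_alg_def stream_alg.sel wp.simps
  proof (rule wp_mono[OF wp_push[OF rep, of 2 u 3 v]])
    fix M'
    assume M': "repr n k M' X p c (push_list X k u v L) \<and> M' 2 = ?M 2 \<and> M' 3 = ?M 3 \<and> M' 8 = ?M 8"
    show "wp S (push_code 3 2) M' (\<lambda>M'. repr n k M' X p c ?L \<and> M' 8 = M 8)"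
      by (rule wp_mono[OF wp_push[of M' X p c "push_list X k u v L" 3 v 2 u]]) (use M' uv in simp_all)
  qed (use uv in simp_all)
  then obtain t M' where 1: "exec S (at_edge dfs_alg) ?M t M'" "t \<le> wcost (at_edge dfs_alg)"
    "repr n k M' X p c ?L" "M' 8 = M 8"
    using wp_runs unfolding runs_def by blast
  have "set (map (\<lambda>(u, v). {u, v}) es) \<subseteq> E - insert {u, v} P"
    "distinct (map (\<lambda>(u, v). {u, v}) es)"
    using Cons.prems(3,4) e by (simp_all add: subset_Diff_insert)
  from Cons.IH[OF 1(3) lists_inv_push[OF Cons.prems(2) uv] this(2,1)]
  obtain t' M'' L' where 2: "read_edges S (at_edge dfs_alg) es M' t' M''"
    "t' \<le> length es * (1 + wcost (at_edge dfs_alg))" "M'' 8 = M' 8" "repr n k M'' X p c L'"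
    "lists_inv n k X (insert {u, v} P \<union> set (map (\<lambda>(u, v). {u, v}) es)) (Suc d + length es) L'"
    by blast
  have "read_edges S (at_edge dfs_alg) (e # es) M (1 + t + t') M''"
    unfolding e using read_edges.Cons[OF _ _ 1(1) 2(1)] vertex_bounds uv by simp
  then show ?case
    using 1 2 e by (intro exI[of _ "1 + t + t'"] exI[of _ M''] exI[of _ L']) simp
qed

text \<open>\<open>X0\<close> are the vertices visited before the pass. A list that overflowed in the pass is harmless:
  once it is used up, \<open>k\<close> vertices have been visited in the pass, so the search has stopped.\<close>

definition lists_sound ::
    "nat \<Rightarrow> nat \<Rightarrow> nat set set \<Rightarrow> nat set \<Rightarrow> nat set \<Rightarrow> (nat \<Rightarrow> nat list) \<Rightarrow> bool"
where
  "lists_sound n k E X0 X L \<longleftrightarrow> (\<forall>u<n. (\<forall>v\<in>set (L u). {u, v} \<in> E) \<and>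
     ((\<forall>v. {u, v} \<in> E \<longrightarrow> v \<in> X \<union> set (L u)) \<or> k \<le> card ((X \<union> set (L u)) - X0)))"

text \<open>A list with room left is complete; a full one holds \<open>k\<close> distinct vertices
  outside \<open>X\<close>, which is the second alternative.\<close>

lemma lists_inv_sound:
  assumes "lists_inv n k X E d L" "\<forall>u<n. length (L u) \<le> k"
  shows "lists_sound n k E X X L"
proof -
  have "k \<le> card ((X \<union> set (L u)) - X)" if "u < n" "\<not> length (L u) < k" for u
  proof -
    have "(X \<union> set (L u)) - X = set (L u)" "distinct (L u)"
      using assms(1) that(1) by (auto simp: lists_inv_def)
    then show ?thesis using that by (simp add: distinct_card)
  qed
  then show ?thesis
    using assms(1) unfolding lists_inv_def lists_sound_def by (metis Un_iff)
qed

text \<open>A popped entry is already visited or gets visited at once, so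
  \<open>X \<union> set (L u)\<close> never shrinks and both alternatives persist.\<close>

lemma lists_sound_mono:
  assumes "lists_sound n k E X0 X L" "finite X'"
    and "\<And>u. set (L' u) \<subseteq> set (L u)" "\<And>u. X \<union> set (L u) \<subseteq> X' \<union> set (L' u)"
  shows "lists_sound n k E X0 X' L'"
  unfolding lists_sound_def
proof (intro allI impI)
  fix u assume "u < n"
  then have u: "\<forall>v\<in>set (L u). {u, v} \<in> E"
    "(\<forall>v. {u, v} \<in> E \<longrightarrow> v \<in> X \<union> set (L u)) \<or> k \<le> card ((X \<union> set (L u)) - X0)"
    using assms(1) unfolding lists_sound_def by simp_all
  have "card ((X \<union> set (L u)) - X0) \<le> card ((X' \<union> set (L' u)) - X0)"
    using assms(2) assms(4)[of u] by (intro card_mono) auto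
  with u show "(\<forall>v\<in>set (L' u). {u, v} \<in> E) \<and>
     ((\<forall>v. {u, v} \<in> E \<longrightarrow> v \<in> X' \<union> set (L' u)) \<or> k \<le> card ((X' \<union> set (L' u)) - X0))"
    using assms(3,4)[of u] by (meson order_trans subsetD)
qed

section \<open>The search within a pass, and the sequence of passes\<close>

locale graph_storage = storage +
  fixes E :: "nat set set"
  assumes ug: "ugraph {..<n} E" and conn: "connected_graph {..<n} E"
begin

text \<open>\<open>X0\<close> is the visited set at the start of the pass, \<open>l\<close> the
  limit and \<open>m\<close> the measure. Popping an entry lowers \<open>m\<close> by one; if its
  vertex is then visited, \<open>h\<close> gains what \<open>n - card X\<close> loses. A step to the
  parent lowers \<open>h\<close>.\<close>

definition search_inv :: "nat set \<Rightarrow> nat \<Rightarrow> nat \<Rightarrow> memory \<Rightarrow> bool" where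
  "search_inv X0 l m M \<longleftrightarrow> (\<exists>X p c L h. repr n k M X p c L \<and> dfs_inv {..<n} E 0 X p c h \<and>
     X0 \<subseteq> X \<and> card X \<le> l \<and> M 8 = l \<and> lists_sound n k E X0 X L \<and>
     m = (\<Sum>u<n. length (L u)) + (n - card X) + h)"

lemma wp_search:
  assumes inv: "search_inv X0 l m M" and l: "l = min n (card X0 + k)" and "M 6 < l"
  shows "wp S search_code M (\<lambda>M'. \<exists>m'<m. search_inv X0 l m' M')"
proof -
  obtain X p c L h where rep: "repr n k M X p c L" and dfs: "dfs_inv {..<n} E 0 X p c h"
    and X0: "X0 \<subseteq> X" and M8: "M 8 = l" and sound: "lists_sound n k E X0 X L"
    and m: "m = (\<Sum>u<n. length (L u)) + (n - card X) + h"
    using inv unfolding search_inv_def by blast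
  have X: "X \<subseteq> {..<n}" "finite X" "c \<in> X"
    using dfs finite_subset by (auto simp: dfs_inv_def)
  then have c: "c < n" by auto
  have less: "card X < l" using \<open>M 6 < l\<close> reprD(4)[OF rep] by simp
  then have card_X: "card X < n" using l by simp
  note facts = reprD(1,2,5)[OF rep] reprD(6,7,9)[OF rep c]
  have count: "length (L c) < S" using facts(6) c bounds by auto
  show ?thesis
  proof (cases "L c = []")
    case True
    \<comment> \<open>Below the limit, fewer than \<open>k\<close> vertices have been visited in
      this pass. The overflow alternative thus fails for the empty list, and \<open>c\<close> is
      finished.\<close>
    have "card (X - X0) = card X - card X0"
      using X0 X(2) by (simp add: card_Diff_subset finite_subset)
    then have "\<not> k \<le> card (X - X0)" using less l k by linarith
    then have fin: "y \<in> X" if "{c, y} \<in> E" for y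
      using sound c True that unfolding lists_sound_def by fastforce
    \<comment> \<open>A finished root would mean that all \<open>n\<close> vertices are visited, but
      the limit, at most \<open>n\<close>, has not been reached.\<close>
    have "c \<noteq> 0"
    proof
      assume "c = 0"
      then have "X = {..<n}" using dfs_inv_root_finished[OF _ conn fin] dfs by simp
      then show False using card_X by simp
    qed
    then obtain g where g: "h = Suc g" "dfs_inv {..<n} E 0 X p (p c) g"
      using dfs_inv_leave[OF dfs fin] by auto
    then have pc: "p c < n" by (auto simp: dfs_inv_def)
    have "search_inv X0 l (m - 1) (M(7 := p c))"
      unfolding search_inv_def
      using repr_move[OF rep] g X0 less M8 sound m
      by (intro exI[of _ X] exI[of _ p] exI[of _ "p c"] exI[of _ L] exI[of _ g]) simp
    moreover have "m - 1 < m" using m g(1) by simp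
    ultimately show ?thesis
      unfolding search_code_def parent_addr_def count_addr_def
      using True by (auto simp: facts bounds c pc)
  next
    case False
    let ?w = "last (L c)" and ?L = "L(c := butlast (L c))"
    have wL: "?w \<in> set (L c)" using False by simp
    then have edge: "{c, ?w} \<in> E" using sound c by (simp add: lists_sound_def)
    then have w: "?w < n" using ugraph_edgeD[OF ug edge] by simp
    have Lc: "set (L c) = insert ?w (set (butlast (L c)))"
      using False by (cases "L c" rule: rev_cases) auto
    have sum: "(\<Sum>u<n. length (?L u)) + 1 = (\<Sum>u<n. length (L u))"
      using sum_length_update[OF c, of L "butlast (L c)"] False
      by (cases "L c" rule: rev_cases) auto
    have visited: "wp S (If (Load (visited_addr (W 9))) Skip visit_code) M' (\<lambda>M'. \<exists>m'<m. search_inv X0 l m' M')"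
      if M': "repr n k M' X p c ?L \<and> M' 9 = ?w \<and> M' 8 = M 8" for M'
    proof (cases "?w \<in> X")
      case True
      have "lists_sound n k E X0 X ?L"
        using sound X(2) by (rule lists_sound_mono) (use Lc True in auto)
      then have "search_inv X0 l (m - 1) M'"
        unfolding search_inv_def
        using M' dfs X0 less M8 m sum
        by (intro exI[of _ X] exI[of _ p] exI[of _ c] exI[of _ ?L] exI[of _ h]) simp
      moreover have "m - 1 < m" using m sum by simp
      ultimately show ?thesis
        unfolding visited_addr_def
        using M' True reprD(1)[of n k M'] reprD(8)[of n k M' X p c ?L ?w] w by (auto simp: bounds)
    next
      case False
      have sound': "lists_sound n k E X0 (insert ?w X) ?L"
        using sound by (rule lists_sound_mono) (use Lc X in auto)
      have dfs': "dfs_inv {..<n} E 0 (insert ?w X) (p(?w := c)) ?w (Suc h)"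
        using dfs_inv_visit[OF dfs _ False edge ug] w by simp
      have "search_inv X0 l (m - 1) M''"
        if "repr n k M'' (insert ?w X) (p(?w := c)) ?w ?L \<and> M'' 8 = M' 8" for M''
        unfolding search_inv_def
        using that M' dfs' sound' X0 less M8 m sum card_X False X(2)
        by (intro exI[of _ "insert ?w X"] exI[of _ "p(?w := c)"] exI[of _ ?w] exI[of _ ?L] exI[of _ "Suc h"]) auto
      moreover have "m - 1 < m" using m sum by simp
      ultimately have visit: "\<exists>m'<m. search_inv X0 l m' M''"
        if "repr n k M'' (insert ?w X) (p(?w := c)) ?w ?L \<and> M'' 8 = M' 8" for M''
        using that by metis
      have "wp S visit_code M' (\<lambda>M'. \<exists>m'<m. search_inv X0 l m' M')"
        using M' w False c X(1) by (intro wp_mono[OF wp_visit[of M' X p c ?L ?w] visit]) simp_all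
      then show ?thesis
        unfolding visited_addr_def
        using M' False reprD(1)[of n k M'] reprD(8)[of n k M' X p c ?L ?w] w by (auto simp: bounds)
    qed
    have "wp S (Seq pop_code (If (Load (visited_addr (W 9))) Skip visit_code)) M
        (\<lambda>M'. \<exists>m'<m. search_inv X0 l m' M')"
      unfolding wp.simps(3) by (rule wp_mono[OF wp_pop[OF rep c False w] visited])
    then show ?thesis
      unfolding search_code_def count_addr_def using False
      by (simp add: facts bounds c count del: wp.simps(3))
  qed
qed

text \<open>The lists are arbitrary here: those left over from the previous pass are stale and get
  cleared.\<close>

definition ready :: "memory \<Rightarrow> bool" where
  "ready M \<longleftrightarrow> M = initial_memory n k \<or>
     (\<exists>X p c L h. repr n k M X p c L \<and> dfs_inv {..<n} E 0 X p c h)"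

lemma dfs_inv_card:
  assumes "dfs_inv {..<n} E 0 X p c h"
  shows "X \<subseteq> {..<n}" "finite X" "0 < card X" "card X \<le> n" "h \<le> card X"
proof -
  show X: "X \<subseteq> {..<n}" "h \<le> card X" using assms by (auto simp: dfs_inv_def)
  then show "finite X" using finite_subset by blast
  then show "0 < card X" using assms card_gt_0_iff by (auto simp: dfs_inv_def)
  show "card X \<le> n" using card_mono[OF _ X(1)] by simp
qed

text \<open>In the first pass \<open>M 6\<close> is 0 while the root is visited by the
  initialisation; hence an inequality between \<open>M 6\<close> and \<open>card X\<close>.\<close>

lemma runs_start:
  assumes "ready M"
  shows "runs S (at_start dfs_alg) M (2000 + 200 * n) (\<lambda>M'. \<exists>X p c L h. repr n k M' X p c L \<and>
    dfs_inv {..<n} E 0 X p c h \<and> (\<forall>u<n. L u = []) \<and> M' 8 = min n (card X + k) \<and> M 6 \<le> card X)"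
proof -
  have "\<exists>X p c L h. wp S init_code M (\<lambda>M'. repr n k M' X p c L) \<and>
      dfs_inv {..<n} E 0 X p c h \<and> M 6 \<le> card X"
    using assms unfolding ready_def
  proof (elim disjE exE conjE)
    assume M: "M = initial_memory n k"
    have "wp S init_code M (\<lambda>M'. repr n k M' {0} (\<lambda>_. 0) 0 (\<lambda>_. []))"
      using M repr_init by (intro wp_init) blast
    moreover have "dfs_inv {..<n} E 0 {0} (\<lambda>_. 0) 0 0" using n by (intro dfs_inv_init) simp
    moreover have "M 6 \<le> card {0::nat}" using M by (simp add: initial_memory_def)
    ultimately show ?thesis by blast
  next
    fix X p c L h
    assume *: "repr n k M X p c L" "dfs_inv {..<n} E 0 X p c h"
    then have "0 < M 6" "M 6 < S" using dfs_inv_card[OF *(2)] reprD(4)[OF *(1)] bounds by auto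
    then have "wp S init_code M (\<lambda>M'. repr n k M' X p c L)" using * by (intro wp_init) blast
    moreover have "M 6 \<le> card X" using reprD(4)[OF *(1)] by simp
    ultimately show ?thesis using * by blast
  qed
  then obtain X p c L h where init: "wp S init_code M (\<lambda>M'. repr n k M' X p c L)"
    and dfs: "dfs_inv {..<n} E 0 X p c h" and le: "M 6 \<le> card X"
    by blast
  let ?Q = "\<lambda>M'. \<exists>L. repr n k M' X p c L \<and> (\<forall>u<n. L u = []) \<and> M' 8 = min n (card X + k)"
  let ?b = "1 + cost (W 9) + n * (1 + cost (W 9) + wcost clear_code)"
  have clear: "runs S (While (W 9) clear_code) M' ?b ?Q"
    if "repr n k M' X p c L \<and> M' 8 = min n (card X + k) \<and> M' 9 = n" for M'
    by (rule runs_mono[OF runs_clear order_refl]) (use that in auto)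
  have limit: "runs S (Seq limit_code (While (W 9) clear_code)) M' (1 + wcost limit_code + ?b) ?Q"
    if "repr n k M' X p c L" for M'
    by (rule runs_Seq, rule runs_mono[OF wp_runs[OF wp_limit[OF that dfs_inv_card(4)[OF dfs]]] order_refl])
      (rule clear)
  have run: "runs S (at_start dfs_alg) M
      (1 + wcost init_code + (1 + wcost limit_code + ?b)) ?Q"
    unfolding dfs_alg_def stream_alg.sel
    by (rule runs_Seq, rule runs_mono[OF wp_runs[OF init] order_refl]) (rule limit)
  have "1 + wcost init_code + (1 + wcost limit_code + ?b) \<le> 2000 + 200 * n"
    by (simp add: init_code_def limit_code_def clear_code_def visited_addr_def count_addr_def)
  with run show ?thesis
    by (rule runs_mono) (use dfs le in blast)
qed

lemma runs_end:
  assumes rep: "repr n k M X p c L" and dfs: "dfs_inv {..<n} E 0 X p c h"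
    and "lists_sound n k E X X L" "(\<Sum>u<n. length (L u)) \<le> 2 * d" "M 8 = min n (card X + k)"
  shows "runs S (at_end dfs_alg) M (2000 + (2 * d + 2 * n) * 500) (\<lambda>M'. \<exists>X' p c L h.
    repr n k M' X' p c L \<and> dfs_inv {..<n} E 0 X' p c h \<and> min n (card X + k) \<le> card X' \<and>
    (M' 4 = 0 \<longleftrightarrow> card X' < n))"
proof -
  let ?l = "min n (card X + k)" and ?e = "Sub (W 8) (W 6)"
  let ?m = "(\<Sum>u<n. length (L u)) + (n - card X) + h"
  have "search_inv X ?l ?m M"
    unfolding search_inv_def using assms dfs_inv_card[OF dfs]
    by (intro exI[of _ X] exI[of _ p] exI[of _ c] exI[of _ L] exI[of _ h]) simp
  moreover have "fits S M' ?e" if "search_inv X ?l m M'" for m M'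
    using that dfs_inv_card reprD(4) bounds unfolding search_inv_def
    by (auto simp: less_imp_diff_less)
  moreover have "runs S search_code M' (wcost search_code) (\<lambda>M''. \<exists>m'<m. search_inv X ?l m' M'')"
    if "search_inv X ?l m M'" "val M' ?e \<noteq> 0" for m M'
  proof -
    have "M' 8 = ?l" using that(1) by (auto simp: search_inv_def)
    then show ?thesis using that by (intro wp_runs wp_search) auto
  qed
  \<comment> \<open>There are at most \<open>2 * d\<close> list entries, and
    \<open>h \<le> card X\<close> gives \<open>n - card X + h \<le> n\<close>.\<close>
  moreover have "?m \<le> 2 * d + 2 * n"
    using assms(4) dfs_inv_card[OF dfs] by linarith
  ultimately have loop: "runs S (While ?e search_code) M
      (1 + cost ?e + (2 * d + 2 * n) * (1 + cost ?e + wcost search_code))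
      (\<lambda>M'. (\<exists>m'. search_inv X ?l m' M') \<and> val M' ?e = 0)"
    using runs_While[of "search_inv X ?l" ?m M S ?e search_code "wcost search_code"] by blast
  let ?s = "Store (Const 4) (Sub (Const 1) (Sub (W 0) (W 6)))"
  let ?Q = "\<lambda>M'. \<exists>X' p c L h.
    repr n k M' X' p c L \<and> dfs_inv {..<n} E 0 X' p c h \<and> ?l \<le> card X' \<and>
    (M' 4 = 0 \<longleftrightarrow> card X' < n)"
  have "runs S ?s M' (wcost ?s) ?Q"
    if M': "(\<exists>m'. search_inv X ?l m' M') \<and> val M' ?e = 0" for M'
  proof (rule wp_runs)
    obtain X' p c L h where *: "repr n k M' X' p c L" "dfs_inv {..<n} E 0 X' p c h"
        "M' 8 = ?l" using M' unfolding search_inv_def by blast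
    have X': "M' 6 = card X'" "M' 0 = n" "card X' \<le> n" "card X' < S" "n - card X' < S"
      using reprD[OF *(1)] dfs_inv_card[OF *(2)] bounds by auto
    have "?l \<le> card X'" using M' * X' by simp
    moreover have "repr n k (M'(4 := 1 - (n - card X'))) X' p c L"
      using *(1) by (intro repr_scratch) auto
    moreover have "(M'(4 := 1 - (n - card X'))) 4 = 0 \<longleftrightarrow> card X' < n" by auto
    ultimately have "?Q (M'(4 := 1 - (n - card X')))"
      using *(2) by (intro exI conjI)
    moreover have "val M' (Sub (Const 1) (Sub (W 0) (W 6))) = 1 - (n - card X')"
      using X' by simp
    moreover have "fits S M' (Const 4)" "fits S M' (Sub (Const 1) (Sub (W 0) (W 6)))"
      using X' constant_bounds by (simp_all add: less_imp_diff_less)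
    ultimately show "wp S ?s M' ?Q"
      unfolding wp.simps(2) val.simps(1) by metis
  qed
  then have "runs S (at_end dfs_alg) M
      (1 + (1 + cost ?e + (2 * d + 2 * n) * (1 + cost ?e + wcost search_code)) + wcost ?s) ?Q"
    unfolding dfs_alg_def stream_alg.sel by (intro runs_Seq runs_mono[OF loop]) auto
  then show ?thesis
  proof (rule runs_mono)
    have "1 + cost ?e + wcost search_code \<le> 500"
      by (simp add: search_code_def pop_code_def visit_code_def parent_addr_def visited_addr_def
          count_addr_def list_addr_def)
    then have "(2 * d + 2 * n) * (1 + cost ?e + wcost search_code) \<le> (2 * d + 2 * n) * 500"
      by (rule mult_le_mono2)
    then show "1 + (1 + cost ?e + (2 * d + 2 * n) * (1 + cost ?e + wcost search_code)) + wcost ?s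
        \<le> 2000 + (2 * d + 2 * n) * 500"
      by simp
  qed
qed

lemma edge_stream_length: "edge_stream E es \<Longrightarrow> finite E \<and> card E = length es"
  unfolding edge_stream_def using distinct_card length_map by (metis List.finite_set)

lemma one_pass_dfs:
  assumes "ready M" "edge_stream E es"
  shows "\<exists>t M' X p c L h. one_pass S dfs_alg es M t M' \<and> t \<le> 4000 * (card E + n + 1) \<and>
    repr n k M' X p c L \<and> dfs_inv {..<n} E 0 X p c h \<and> min n (M 6 + k) \<le> card X \<and>
    (M' 4 = 0 \<longleftrightarrow> card X < n)"
proof -
  obtain t\<^sub>1 M\<^sub>1 X p c L h where 1: "exec S (at_start dfs_alg) M t\<^sub>1 M\<^sub>1" "t\<^sub>1 \<le> 2000 + 200 * n"
    "repr n k M\<^sub>1 X p c L" "dfs_inv {..<n} E 0 X p c h" "\<forall>u<n. L u = []"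
    "M\<^sub>1 8 = min n (card X + k)" "M 6 \<le> card X"
    using runs_start[OF assms(1)] unfolding runs_def by blast
  have "lists_inv n k X {} 0 L" using 1(5) by (simp add: lists_inv_def)
  moreover have es: "distinct (map (\<lambda>(u, v). {u, v}) es)" "set (map (\<lambda>(u, v). {u, v}) es) = E"
    using assms(2) by (auto simp: edge_stream_def)
  ultimately obtain t\<^sub>2 M\<^sub>2 L\<^sub>2 where 2: "read_edges S (at_edge dfs_alg) es M\<^sub>1 t\<^sub>2 M\<^sub>2"
    "t\<^sub>2 \<le> length es * (1 + wcost (at_edge dfs_alg))" "M\<^sub>2 8 = M\<^sub>1 8" "repr n k M\<^sub>2 X p c L\<^sub>2"
    "lists_inv n k X E (length es) L\<^sub>2"
    using read_edges_push[OF ug 1(3), of "{}" 0 es] by auto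
  have "lists_sound n k E X X L\<^sub>2"
    using lists_inv_sound[OF 2(5)] reprD(9)[OF 2(4)] by blast
  moreover have "(\<Sum>u<n. length (L\<^sub>2 u)) \<le> 2 * length es" using 2(5) by (simp add: lists_inv_def)
  ultimately obtain t\<^sub>3 M\<^sub>3 X\<^sub>3 p\<^sub>3 c\<^sub>3 L\<^sub>3 h\<^sub>3 where 3: "exec S (at_end dfs_alg) M\<^sub>2 t\<^sub>3 M\<^sub>3"
    "t\<^sub>3 \<le> 2000 + (2 * length es + 2 * n) * 500"
    "repr n k M\<^sub>3 X\<^sub>3 p\<^sub>3 c\<^sub>3 L\<^sub>3" "dfs_inv {..<n} E 0 X\<^sub>3 p\<^sub>3 c\<^sub>3 h\<^sub>3"
    "min n (card X + k) \<le> card X\<^sub>3" "M\<^sub>3 4 = 0 \<longleftrightarrow> card X\<^sub>3 < n"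
    using runs_end[OF 2(4) 1(4), of "length es"] 1(6) 2(3) unfolding runs_def by auto
  have "1 + wcost (at_edge dfs_alg) \<le> 500"
    by (simp add: dfs_alg_def push_code_def visited_addr_def count_addr_def list_addr_def)
  then have "t\<^sub>2 \<le> length es * 500"
    using 2(2) mult_le_mono2 order_trans by blast
  \<comment> \<open>The three phases add up to at most 4000 plus 1500 per edge and 1200 per
    vertex.\<close>
  then have "t\<^sub>1 + t\<^sub>2 + t\<^sub>3 \<le> 4000 * (card E + n + 1)"
    using 1(2) 3(2) edge_stream_length[OF assms(2)] by simp
  moreover have "one_pass S dfs_alg es M (t\<^sub>1 + t\<^sub>2 + t\<^sub>3) M\<^sub>3"
    using 1(1) 2(1) 3(1) by (rule one_pass.intros)
  moreover have "min n (M 6 + k) \<le> card X\<^sub>3" using 1(7) 3(5) by linarith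
  ultimately show ?thesis using 3(3,4,6) by (intro exI conjI)
qed

text \<open>A pass that is not the last raises word 6 by at least \<open>k\<close> and so uses up
  one of the \<open>j\<close> passes. The assumption \<open>M 6 < n\<close> excludes
  \<open>j = 0\<close>, as the algorithm always makes a pass.\<close>

lemma passes_dfs:
  assumes "ready M" "M 6 < n" "n - M 6 \<le> j * k" "\<forall>i. edge_stream E (es i)"
  shows "\<exists>ts M'. passes S dfs_alg es M ts M' \<and> length ts \<le> j \<and>
    (\<forall>t\<in>set ts. t \<le> 4000 * (card E + n + 1)) \<and>
    (\<exists>p c L h. repr n k M' {..<n} p c L \<and> dfs_inv {..<n} E 0 {..<n} p c h)"
  using assms
proof (induction j arbitrary: M es)
  case (Suc j)
  obtain t M' X p c L h where 1: "one_pass S dfs_alg (es 0) M t M'" "t \<le> 4000 * (card E + n + 1)"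
    "repr n k M' X p c L" "dfs_inv {..<n} E 0 X p c h" "min n (M 6 + k) \<le> card X"
    "M' 4 = 0 \<longleftrightarrow> card X < n"
    using one_pass_dfs[OF Suc.prems(1) Suc.prems(4)[rule_format, of 0]] by (elim exE conjE)
  show ?case
  proof (cases "card X < n")
    case True
    have "ready M'" using 1 unfolding ready_def by blast
    moreover have "M' 6 < n" using reprD(4)[OF 1(3)] True by simp
    moreover have "n - M' 6 \<le> j * k" using reprD(4)[OF 1(3)] 1(5) True Suc.prems(3) by simp
    ultimately obtain ts M'' p' c' L' h' where "passes S dfs_alg (\<lambda>i. es (Suc i)) M' ts M''"
      "length ts \<le> j" "\<forall>t\<in>set ts. t \<le> 4000 * (card E + n + 1)"
      "repr n k M'' {..<n} p' c' L'" "dfs_inv {..<n} E 0 {..<n} p' c' h'"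
      using Suc.IH[of M' "\<lambda>i. es (Suc i)"] Suc.prems(4) by blast
    moreover from this(1) have "passes S dfs_alg es M (t # ts) M''"
      using passes.More[of S dfs_alg es M t M' ts M''] 1(1,6) True by simp
    ultimately show ?thesis
      using 1(2) by (intro exI[of _ "t # ts"] exI[of _ M'']) (simp, blast)
  next
    case False
    then have "X = {..<n}"
      using dfs_inv_card[OF 1(4)] card_subset_eq[of "{..<n}" X] by simp
    moreover have "passes S dfs_alg es M [t] M'"
      using passes.Last[of S dfs_alg es M t M'] 1(1,6) False by simp
    ultimately show ?thesis
      using 1(2-4) by (intro exI[of _ "[t]"] exI[of _ M']) (simp, blast)
  qed
qed simp

end

section \<open>The inverse Ackermann factor and the final bounds\<close>

lemma ack_gt_add: "i + j < ack i j"
  by (induction i j rule: ack.induct) auto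

text \<open>\<open>LEAST\<close> needs a witness: by \<open>ack_gt_add\<close>, the index
  \<open>Suc i\<close> qualifies as soon as \<open>i\<close> is at least \<open>log 2 n\<close>,
  whatever \<open>m div n\<close> is.\<close>

lemma inv_ack_pos: "1 \<le> inv_ack m n"
proof -
  obtain i :: nat where i: "log 2 (real n) \<le> real i" using real_arch_simple by blast
  have "real i \<le> real (ack (Suc i) (m div n))"
    using ack_gt_add[of "Suc i" "m div n"] by simp
  then have "1 \<le> Suc i \<and> log 2 (real n) \<le> real (ack (Suc i) (m div n))" using i by simp
  then show ?thesis unfolding inv_ack_def by (rule LeastI2) simp
qed

theorem theorem1p1:
  shows "\<exists>(A :: stream_alg) (C :: nat). \<forall>(k :: nat) (n :: nat) (E :: nat set set) (es :: nat \<Rightarrow> stream).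
    k \<ge> 1 \<longrightarrow> ugraph {..<n} E \<longrightarrow> connected_graph {..<n} E \<longrightarrow> (\<forall>i. edge_stream E (es i)) \<longrightarrow>
    (\<exists>ts M. run (C * (n * k)) A n k es ts M \<and>
       outputs_dfs_tree (C * (n * k)) M n E \<and>
       int (length ts) \<le> \<lceil>real n / real k\<rceil> \<and>
       (\<forall>t\<in>set ts. t \<le> C * (card E * inv_ack (card E) n + 1)))"
\<comment> \<open>With \<open>n \<le> card E + 1\<close>, the bound
  \<open>4000 * (card E + n + 1)\<close> is at most \<open>8000 * (card E + 1)\<close>; as storage
  factor, 8000 exceeds the required 100.\<close>
proof (intro exI[of _ dfs_alg] exI[of _ 8000] allI impI)
  fix k n :: nat and E :: "nat set set" and es :: "nat \<Rightarrow> stream"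
  assume k: "1 \<le> k" and ug: "ugraph {..<n} E" and conn: "connected_graph {..<n} E"
    and es: "\<forall>i. edge_stream E (es i)"
  let ?S = "8000 * (n * k)"
  have n: "1 \<le> n" using conn by (cases n) (auto simp: connected_graph_def)
  interpret graph_storage ?S n k E
    using n k ug conn by unfold_locales auto
  define j where "j = nat \<lceil>real n / real k\<rceil>"
  have "0 \<le> real n / real k" by simp
  then have "0 \<le> \<lceil>real n / real k\<rceil>" by linarith
  then have j: "int j = \<lceil>real n / real k\<rceil>" by (simp add: j_def)
  then have "real n / real k \<le> real j" by (metis le_of_int_ceiling of_int_of_nat_eq)
  then have "real n \<le> real (j * k)" using k by (simp add: divide_le_eq)
  then have "n \<le> j * k" by linarith
  moreover have "initial_memory n k 6 = 0" by (simp add: initial_memory_def)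
  moreover have "ready (initial_memory n k)" by (simp add: ready_def)
  ultimately obtain ts M p c L h where res: "passes ?S dfs_alg es (initial_memory n k) ts M"
    "length ts \<le> j" "\<forall>t\<in>set ts. t \<le> 4000 * (card E + n + 1)"
    "repr n k M {..<n} p c L" "dfs_inv {..<n} E 0 {..<n} p c h"
    using passes_dfs[of "initial_memory n k" j es] es n by auto
  have p: "parent_of M v = p v" if "v < n" for v
    using reprD(3)[OF res(4)] reprD(6)[OF res(4) that] by (simp add: parent_of_def)
  have "{{v, parent_of M v} | v. v < n \<and> v \<noteq> 0} = {{v, p v} | v. v \<in> {..<n} \<and> v \<noteq> 0}"
    using p by auto
  then have "dfs_tree {..<n} E 0 {{v, parent_of M v} | v. v < n \<and> v \<noteq> 0}"
    using dfs_inv_complete(1)[OF res(5) ug] by simp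
  moreover have "parent_of M 0 = 0"
    using p[of 0] n res(5) parent_tree.parent_root by (auto simp: dfs_inv_def)
  ultimately have out: "outputs_dfs_tree ?S M n E"
    unfolding outputs_dfs_tree_def using n constant_bounds reprD(3)[OF res(4)]
    by (intro conjI exI[of _ 0]) auto
  define a where "a = card E * inv_ack (card E) n"
  have "card E \<le> a"
    using mult_le_mono2[OF inv_ack_pos, of "card E" "card E" n] unfolding a_def mult_1_right .
  moreover have "n \<le> card E + 1"
    using dfs_inv_complete(2)[OF res(5) ug] edge_stream_length es by auto
  ultimately have "4000 * (card E + n + 1) \<le> 8000 * (card E * inv_ack (card E) n + 1)"
    unfolding a_def[symmetric] by simp
  then have "\<forall>t\<in>set ts. t \<le> 8000 * (card E * inv_ack (card E) n + 1)"
    using res(3) order_trans by blast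
  moreover have "run ?S dfs_alg n k es ts M"
    unfolding run_def using res(1) constant_bounds by simp
  moreover have "int (length ts) \<le> \<lceil>real n / real k\<rceil>" using res(2) j by linarith
  ultimately show "\<exists>ts M. run ?S dfs_alg n k es ts M \<and> outputs_dfs_tree ?S M n E \<and>
      int (length ts) \<le> \<lceil>real n / real k\<rceil> \<and>
      (\<forall>t\<in>set ts. t \<le> 8000 * (card E * inv_ack (card E) n + 1))"
    using out by (intro exI[of _ ts] exI[of _ M] conjI)
qed

end
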